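(* Every connected planar graph $G$ with girth at least $6$ is a Gallai graph; that is, if $n$ denotes the number of non-isolated vertices of $G$, then $\mathrm{pn}(G)\le\lfloor n/2\rfloor$.
   Context: All graphs are finite and simple. A path decomposition of a graph $G$ is a set of pairwise edge-disjoint paths of $G$ that together cover $E(G)$; $\mathrm{pn}(G)$ is the minimum size of a path decomposition of $G$ (it is $0$ if $G$ has no edges). A graph $G$ with $n$ non-isolated vertices (vertices of positive degree) is called a Gallai graph if $\mathrm{pn}(G)\le\lfloor n/2\rfloor$. The girth of a graph is the length of its shortest cycle, taken to be infinite if there is no cycle. *)

theory Defs
  imports "HOL-Analysis.Analysis" "HOL-Library.Extended_Nat"
begin

definition simple_graph :: "'a set \<Rightarrow> 'a set set \<Rightarrow> bool" where
  "simple_graph V E \<longleftrightarrow> finite V \<and> (\<forall>e\<in>E. e \<subseteq> V \<and> card e = 2)"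

fun walk_edges :: "'a list \<Rightarrow> 'a set set" where
  "walk_edges (u # v # p) = insert {u, v} (walk_edges (v # p))"
| "walk_edges p = {}"

definition graph_path :: "'a set \<Rightarrow> 'a set set \<Rightarrow> 'a list \<Rightarrow> bool" where
  "graph_path V E p \<longleftrightarrow> p \<noteq> [] \<and> distinct p \<and> set p \<subseteq> V \<and> walk_edges p \<subseteq> E"

definition graph_cycle :: "'a set \<Rightarrow> 'a set set \<Rightarrow> 'a list \<Rightarrow> bool" where
  "graph_cycle V E c \<longleftrightarrow> graph_path V E c \<and> length c \<ge> 3 \<and> {last c, hd c} \<in> E"

definition graph_connected :: "'a set \<Rightarrow> 'a set set \<Rightarrow> bool" where
  "graph_connected V E \<longleftrightarrow>
     (\<forall>u\<in>V. \<forall>v\<in>V. \<exists>p. graph_path V E p \<and> hd p = u \<and> last p = v)"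

text \<open>The infimum of the empty set in \<^typ>\<open>enat\<close> is \<open>\<infinity>\<close>, so acyclic graphs have infinite girth.\<close>
definition girth :: "'a set \<Rightarrow> 'a set set \<Rightarrow> enat" where
  "girth V E = (INF c \<in> {c. graph_cycle V E c}. enat (length c))"

text \<open>A drawing in the plane: distinct points for the vertices, and for each edge a simple arc
  joining its end points that contains no other vertex and meets the arc of another edge only in
  the image of a common end point.\<close>
definition plane_drawing ::
  "'a set \<Rightarrow> 'a set set \<Rightarrow> ('a \<Rightarrow> complex) \<Rightarrow> ('a set \<Rightarrow> real \<Rightarrow> complex) \<Rightarrow> bool" where
  "plane_drawing V E pos \<gamma> \<longleftrightarrow>
     inj_on pos V \<and>
     (\<forall>e\<in>E. arc (\<gamma> e) \<and> {pathstart (\<gamma> e), pathfinish (\<gamma> e)} = pos ` e \<and>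
        path_image (\<gamma> e) \<inter> pos ` V = pos ` e) \<and>
     (\<forall>e\<in>E. \<forall>f\<in>E. e \<noteq> f \<longrightarrow>
        path_image (\<gamma> e) \<inter> path_image (\<gamma> f) = pos ` (e \<inter> f))"

definition planar :: "'a set \<Rightarrow> 'a set set \<Rightarrow> bool" where
  "planar V E \<longleftrightarrow> (\<exists>pos \<gamma>. plane_drawing V E pos \<gamma>)"

text \<open>Paths are represented by vertex lists. A path with an edge and its reversal are not
  edge-disjoint, so every path with an edge is represented in such a set by at most one list.
  The set is finite for a simple graph, as the lists are distinct lists over \<open>V\<close>.\<close>
definition path_decomposition :: "'a set \<Rightarrow> 'a set set \<Rightarrow> 'a list set \<Rightarrow> bool" where
  "path_decomposition V E D \<longleftrightarrow>
     (\<forall>p\<in>D. graph_path V E p) \<and>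
     pairwise (\<lambda>p q. disjnt (walk_edges p) (walk_edges q)) D \<and>
     (\<Union>p\<in>D. walk_edges p) = E"

definition pn :: "'a set \<Rightarrow> 'a set set \<Rightarrow> nat" where
  "pn V E = (LEAST k. \<exists>D. path_decomposition V E D \<and> card D = k)"

definition degree :: "'a set set \<Rightarrow> 'a \<Rightarrow> nat" where
  "degree E v = card {e \<in> E. v \<in> e}"

definition gallai_graph :: "'a set \<Rightarrow> 'a set set \<Rightarrow> bool" where
  "gallai_graph V E \<longleftrightarrow> pn V E \<le> card {v \<in> V. degree E v > 0} div 2"

end

theory Submission imports Defs begin

text \<open>Take a graph that is not necessarily connected and induct on its number of edges. It suffices
  to find two vertices \<open>u\<close>, \<open>v\<close> of degree at most 2 in one component: a shortest path from \<open>u\<close> to \<open>v\<close>,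
  prolonged by the remaining edges at \<open>u\<close> and \<open>v\<close>, is still a path since there are no cycles of length 3
  or 4. Removing its edges isolates \<open>u\<close> and \<open>v\<close>, so one path pays for two vertices.

  If all but at most one vertex of a component with \<open>n\<close> vertices had degree at least 3, the component
  would have at least \<open>(3n - 2) / 2\<close> edges. But a plane graph of girth at least 6 has at most
  \<open>(3n - 3) / 2\<close> edges, by Euler's formula and double counting of edges and faces. Both rest on
  Janiszewski's theorem and the Jordan curve theorem: a new edge between different components of the
  drawing replaces one face by one face, and a new edge inside a component replaces one face by two.
  An edge is counted at a face if the face is destroyed by deleting the edge, hence at most twice. A
  face is also a face of the subgraph formed by its edges, and if these were fewer than 6 then this
  subgraph would be a forest and have only one face.\<close>

section \<open>Attaching an arc to a compact set\<close>

text \<open>The inverse of the arc, read as a complex function with real values, would embed a ball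
  of the image in the real line. By invariance of domain the image of the ball would be open in the
  plane, yet it contains no point off the real line.\<close>

lemma arc_empty_interior:
  fixes g :: "real \<Rightarrow> complex"
  assumes "arc g"
  shows "interior (path_image g) = {}"
proof (rule ccontr)
  assume "interior (path_image g) \<noteq> {}"
  then obtain z r where r: "r > 0" "ball z r \<subseteq> path_image g"
    by (meson ex_in_conv mem_interior)
  obtain h where h: "homeomorphism {0..1} (path_image g) g h"
    using homeomorphism_arc[OF assms] by blast
  have inj: "inj_on h (path_image g)"
    using h by (metis homeomorphism_def inj_on_inverseI)
  let ?f = "\<lambda>w. complex_of_real (h w)"
  have cont: "continuous_on (ball z r) ?f"
    using continuous_on_subset[OF homeomorphism_cont2[OF h] r(2)] by (rule continuous_on_of_real)
  have "inj_on ?f (ball z r)"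
    using inj r(2) by (auto simp: inj_on_def)
  with cont have "open (?f ` ball z r)"
    by (intro invariance_of_domain) auto
  then have "?f z \<in> interior (?f ` ball z r)"
    using r(1) by (simp add: interior_open)
  then obtain e where e: "e > 0" "ball (?f z) e \<subseteq> ?f ` ball z r"
    by (meson mem_interior)
  have "?f z + \<i> * of_real (e/2) \<in> ball (?f z) e"
    using e(1) by (simp add: dist_norm norm_mult)
  with e(2) obtain w where "?f z + \<i> * of_real (e/2) = ?f w" by blast
  then have "Im (?f z + \<i> * of_real (e/2)) = 0" by simp
  then show False using e(1) by simp
qed

text \<open>All that \<open>P\<close> adds to \<open>X\<close> lies in \<open>G\<close>, so the
  other components survive untouched and only \<open>G\<close> is cut up. Both inclusions transfer
  maximality among connected sets between the two complements.\<close>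

lemma components_attach:
  fixes X P G :: "'a::topological_space set"
  assumes G: "G \<in> components (-X)" and PG: "P - X \<subseteq> G"
  shows "components (-(X \<union> P)) = (components (-X) - {G}) \<union> components (G - P)"
proof (intro equalityI subsetI)
  fix h assume h: "h \<in> components (-(X \<union> P))"
  then have hc: "connected h" "h \<noteq> {}" "h \<subseteq> -(X \<union> P)"
    and hmax: "\<And>d. d \<noteq> {} \<Longrightarrow> h \<subseteq> d \<Longrightarrow> d \<subseteq> -(X \<union> P) \<Longrightarrow> connected d \<Longrightarrow> d = h"
    by (auto simp: in_components_maximal)
  obtain g where g: "g \<in> components (-X)" "h \<subseteq> g"
    using exists_component_superset[of h "-X"] hc by blast
  show "h \<in> (components (-X) - {G}) \<union> components (G - P)"
  proof (cases "g = G")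
    case True
    have "h \<in> components (G - P)"
      unfolding in_components_maximal
    proof (intro conjI allI impI)
      show "h \<subseteq> G - P" using hc g True by auto
      fix d assume "d \<noteq> {} \<and> h \<subseteq> d \<and> d \<subseteq> G - P \<and> connected d"
      moreover then have "d \<subseteq> -(X \<union> P)" using in_components_subset[OF G] by auto
      ultimately show "d = h" using hmax by auto
    qed (use hc in auto)
    then show ?thesis by simp
  next
    case False
    then have "g \<inter> G = {}" using components_nonoverlap g(1) G by blast
    moreover have "g \<subseteq> -X" using in_components_subset g by blast
    ultimately have "g \<subseteq> -(X \<union> P)" using PG by auto
    then have "g = h"
      using g hmax in_components_nonempty in_components_connected by metis
    then show ?thesis using g False by auto
  qed
next
  fix h assume "h \<in> (components (-X) - {G}) \<union> components (G - P)"
  then consider "h \<in> components (-X)" "h \<noteq> G" | "h \<in> components (G - P)" by auto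
  then show "h \<in> components (-(X \<union> P))"
  proof cases
    case 1
    then have "h \<inter> G = {}" using components_nonoverlap G by blast
    then have "h \<subseteq> -(X \<union> P)" using PG in_components_subset[OF 1(1)] by auto
    then show ?thesis using 1(1)
      by (metis Compl_anti_mono Un_upper1 components_intermediate_subset)
  next
    case 2
    have hG: "h \<subseteq> G - P" "h \<noteq> {}" "connected h"
      using 2 by (auto simp: in_components_maximal)
    show ?thesis
      unfolding in_components_maximal
    proof (intro conjI allI impI)
      show "h \<subseteq> -(X \<union> P)" using hG in_components_subset[OF G] by auto
      fix d assume d: "d \<noteq> {} \<and> h \<subseteq> d \<and> d \<subseteq> -(X \<union> P) \<and> connected d"
      then have "d \<subseteq> G"
        using hG by (intro components_maximal[OF G]) auto
      then have "d \<subseteq> G - P" using d by auto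
      then show "d = h" using d 2[unfolded in_components_maximal] by metis
    qed (use hG in auto)
  qed
qed

text \<open>An arc without its end points is connected, so it runs inside a single component
  \<open>G\<close>. As \<open>G\<close> is open and an arc has empty interior, something of
  \<open>G\<close> remains.\<close>

lemma arc_attach:
  fixes X :: "complex set" and g :: "real \<Rightarrow> complex"
  assumes X: "compact X" and g: "arc g"
    and gX: "path_image g \<inter> X = {pathstart g, pathfinish g}"
  obtains G where "G \<in> components (-X)" "open G" "path_image g - X \<subseteq> G"
    "G - path_image g \<noteq> {}" "\<not> G \<inter> path_image g = {}"
    "components (-(X \<union> path_image g)) =
       (components (-X) - {G}) \<union> components (G - path_image g)"
proof -
  let ?P = "path_image g"
  have eq: "?P - X = ?P - {pathstart g, pathfinish g}" using gX by auto
  have ne: "?P - X \<noteq> {}" and con: "connected (?P - X)"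
    using nonempty_simple_path_endless connected_simple_path_endless arc_imp_simple_path[OF g]
    by (metis eq)+
  obtain G where G: "G \<in> components (-X)" "?P - X \<subseteq> G"
    using exists_component_superset[of "?P - X" "-X"] ne con by blast
  have op: "open G" using G(1) X compact_imp_closed open_components by blast
  moreover have "G - ?P \<noteq> {}"
    using arc_empty_interior[OF g] in_components_nonempty[OF G(1)] op interior_maximal[of G ?P] by auto
  ultimately show thesis using that G components_attach[OF G] ne by blast
qed

text \<open>Nothing is separated, by Janiszewski's theorem used twice: the arc meets
  \<open>X1\<close> in one point, and the arc together with \<open>X1\<close> meets
  \<open>X2\<close> in one point. That \<open>H\<close> is new keeps the count of components
  exact.\<close>

lemma attach_bridge:
  fixes X1 X2 :: "complex set" and g :: "real \<Rightarrow> complex"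
  assumes X: "compact X1" "compact X2" "X1 \<inter> X2 = {}" and g: "arc g"
    and g1: "path_image g \<inter> X1 = {pathstart g}" and g2: "path_image g \<inter> X2 = {pathfinish g}"
  obtains G H where "G \<in> components (-(X1 \<union> X2))" "H \<notin> components (-(X1 \<union> X2))"
    "components (-(X1 \<union> X2 \<union> path_image g)) = insert H (components (-(X1 \<union> X2)) - {G})"
proof -
  let ?X = "X1 \<union> X2" and ?P = "path_image g"
  have cX: "compact ?X" using X by auto
  have gX: "?P \<inter> ?X = {pathstart g, pathfinish g}" using g1 g2 by auto
  obtain G where G: "G \<in> components (-?X)" "open G" "?P - ?X \<subseteq> G" "G - ?P \<noteq> {}" "G \<inter> ?P \<noteq> {}"
    and C: "components (-(?X \<union> ?P)) = (components (-?X) - {G}) \<union> components (G - ?P)"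
    using arc_attach[OF cX g gX] by metis
  \<comment> \<open>Two points left over in \<open>G\<close> are separated neither by the arc nor by
    \<open>X1\<close> nor by \<open>X2\<close>; the three sets are united one after the
    other.\<close>
  have sep: "connected_component (-(?X \<union> ?P)) a b"
    if a: "a \<in> G - ?P" and b: "b \<in> G - ?P" for a b
  proof -
    have conX: "connected_component (-?X) a b"
      using a b G(1) by (metis DiffD1 connected_component_def in_components_connected in_components_subset)
    have conP: "connected_component (-?P) a b"
      using a b connected_arc_complement[OF g]
      by (metis ComplI DIM_complex DiffD2 connected_component_def le_refl subset_refl)
    have con1: "connected_component (-X1) a b" "connected_component (-X2) a b"
      using conX by (metis Compl_anti_mono Un_upper1 Un_upper2 connected_component_of_subset)+
    have P: "compact ?P" using g by (simp add: compact_arc_image)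
    have "connected_component (-(?P \<union> X1)) a b"
      by (rule Janiszewski[OF P compact_imp_closed[OF X(1)] _ conP con1(1)]) (simp add: g1)
    moreover have "(?P \<union> X1) \<inter> X2 = {pathfinish g}" using g2 X(3) by auto
    ultimately have "connected_component (-((?P \<union> X1) \<union> X2)) a b"
      using Janiszewski[OF compact_Un[OF P X(1)] compact_imp_closed[OF X(2)]] con1(2) by simp
    then show ?thesis by (simp add: Un_ac)
  qed
  have "connected (G - ?P)"
    unfolding connected_iff_connected_component
  proof (intro ballI)
    fix a b assume ab: "a \<in> G - ?P" "b \<in> G - ?P"
    then obtain T where T: "connected T" "T \<subseteq> -(?X \<union> ?P)" "a \<in> T" "b \<in> T"
      using sep by (metis connected_component_def)
    then have "T \<subseteq> G"
      using ab by (intro components_maximal[OF G(1)]) auto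
    then show "connected_component (G - ?P) a b"
      using T unfolding connected_component_def by blast
  qed
  then have comp: "components (G - ?P) = {G - ?P}"
    using G(4) by (simp add: components_eq_sing_iff)
  \<comment> \<open>A component that meets \<open>G\<close> equals \<open>G\<close>, but the arc has
    removed points from it.\<close>
  have "G - ?P \<notin> components (-?X)"
    using components_nonoverlap[OF G(1)] G(4,5) by (metis Diff_disjoint Int_Diff inf.idem inf_commute Diff_eq_empty_iff)
  then show thesis using that G(1) C comp by auto
qed

text \<open>The arc \<open>d\<close> inside \<open>X\<close> closes \<open>g\<close> to a Jordan
  curve. The inside and the outside of this curve each meet \<open>G\<close> in a nonempty connected
  set, and these two sets are the pieces of \<open>G\<close>.\<close>

lemma attach_chord:
  fixes X :: "complex set" and g d :: "real \<Rightarrow> complex"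
  assumes X: "compact X" and g: "arc g" and gX: "path_image g \<inter> X = {pathstart g, pathfinish g}"
    and d: "arc d" "path_image d \<subseteq> X" "pathstart d = pathfinish g" "pathfinish d = pathstart g"
  obtains G H K where "G \<in> components (-X)" "H \<notin> components (-X)" "K \<notin> components (-X)" "H \<noteq> K"
    "components (-(X \<union> path_image g)) = insert H (insert K (components (-X) - {G}))"
proof -
  let ?P = "path_image g" and ?D = "path_image d"
  define c where "c = g +++ d"
  let ?C = "path_image c"
  have cC: "?C = ?P \<union> ?D" unfolding c_def using d by (simp add: path_image_join)
  have gd: "?P \<inter> ?D = {pathstart g, pathfinish g}"
    using gX d by (auto simp: pathstart_in_path_image pathfinish_in_path_image)
      (metis pathstart_in_path_image pathfinish_in_path_image)+
  have sc: "simple_path c"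
    unfolding c_def using g d gd by (intro simple_path_join_loop) auto
  have loop: "pathfinish c = pathstart c" unfolding c_def using d by simp
  note J = Jordan_inside_outside[OF sc loop]
  obtain G where G: "G \<in> components (-X)" "open G" "?P - X \<subseteq> G" "G - ?P \<noteq> {}" "G \<inter> ?P \<noteq> {}"
    and C: "components (-(X \<union> ?P)) = (components (-X) - {G}) \<union> components (G - ?P)"
    using arc_attach[OF X g gX] by metis
  have GX: "G \<inter> X = {}" using in_components_subset[OF G(1)] by auto
  \<comment> \<open>\<open>X\<close> and the curve meet exactly in the arc \<open>d\<close>, which
    is connected, so Janiszewski's theorem applies to this pair.\<close>
  have sep: "connected_component (-(X \<union> ?C)) a b"
    if "a \<in> G" "b \<in> G" "connected_component (-?C) a b" for a b
  proof (rule Janiszewski)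
    have "X \<inter> ?C = ?D" using cC gX gd d by auto
    then show "connected (X \<inter> ?C)" using d by (simp add: connected_arc_image)
    show "connected_component (-X) a b"
      using that G(1) by (metis connected_component_def in_components_connected in_components_subset)
  qed (use X sc that in \<open>auto simp: closed_simple_path_image\<close>)
  have XC: "X \<union> ?C = X \<union> ?P" using cC d by auto
  have part: "connected (G \<inter> S) \<and> G \<inter> S \<noteq> {} \<and> G \<inter> S \<in> components (G - ?P)"
    if S: "S \<in> components (-?C)" "frontier S = ?C" for S
  proof -
    have SC: "connected S" "S \<subseteq> -?C"
      using in_components_connected[OF S(1)] in_components_subset[OF S(1)] by auto
    have "connected (G \<inter> S)"
      unfolding connected_iff_connected_component
    proof (intro ballI)
      fix a b assume ab: "a \<in> G \<inter> S" "b \<in> G \<inter> S"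
      then have "connected_component (-?C) a b"
        using SC by (auto simp: connected_component_def)
      then obtain T where T: "connected T" "T \<subseteq> -(X \<union> ?C)" "a \<in> T" "b \<in> T"
        using sep[of a b] ab by (auto simp: connected_component_def)
      have "T \<subseteq> G" using T ab by (intro components_maximal[OF G(1)]) auto
      moreover have "T \<subseteq> S" using T ab by (intro components_maximal[OF S(1)]) auto
      ultimately show "connected_component (G \<inter> S) a b"
        using T unfolding connected_component_def by blast
    qed
    \<comment> \<open>The new arc lies on the frontier of \<open>S\<close>, and the open set
      \<open>G\<close> contains points of it, so \<open>G\<close> reaches into
      \<open>S\<close>.\<close>
    moreover have "G \<inter> S \<noteq> {}"
    proof -
      obtain z where z: "z \<in> G" "z \<in> ?P" using G(5) by auto
      then have "z \<in> closure S" using S(2) cC by (auto simp: frontier_def)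
      then show ?thesis using z G(2) by (metis open_Int_closure_eq_empty disjoint_iff inf_commute)
    qed
    moreover have "d = G \<inter> S"
      if "d \<noteq> {}" "G \<inter> S \<subseteq> d" "d \<subseteq> G - ?P" "connected d" for d
    proof -
      have "d \<subseteq> S"
        using that GX cC \<open>path_image _ \<subseteq> X\<close> \<open>G \<inter> S \<noteq> {}\<close>
        by (intro components_maximal[OF S(1)]) auto
      then show ?thesis using that by auto
    qed
    moreover have "G \<inter> S \<subseteq> G - ?P" using SC cC by auto
    ultimately show ?thesis unfolding in_components_maximal[of "G \<inter> S"] by blast
  qed
  let ?I = "inside ?C" and ?O = "outside ?C"
  have IO: "?I \<union> ?O = -?C" "?I \<inter> ?O = {}"  using J by auto
  have "?I \<in> components (-?C)" "?O \<in> components (-?C)"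
    using J by (auto simp: inside_in_components outside_in_components compact_simple_path_image
        closed_simple_path_image sc compact_imp_bounded) 
  then have pI: "G \<inter> ?I \<noteq> {}" "G \<inter> ?I \<in> components (G - ?P)"
    and pO: "G \<inter> ?O \<noteq> {}" "G \<inter> ?O \<in> components (G - ?P)"
    using part J by auto
  have GP: "G - ?P = (G \<inter> ?I) \<union> (G \<inter> ?O)"
  proof -
    have "G - ?P = G \<inter> -?C" using cC GX d(2) by auto
    then show ?thesis by (metis IO(1) Int_Un_distrib)
  qed
  have comp: "components (G - ?P) = {G \<inter> ?I, G \<inter> ?O}"
  proof -
    have "h = G \<inter> ?I \<or> h = G \<inter> ?O" if "h \<in> components (G - ?P)" for h
    proof -
      have "h \<noteq> {}" "h \<subseteq> G - ?P"
        using in_components_nonempty[OF that] in_components_subset[OF that] by auto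
      then have "h \<inter> (G \<inter> ?I) \<noteq> {} \<or> h \<inter> (G \<inter> ?O) \<noteq> {}" using GP by auto
      then show ?thesis using components_nonoverlap that pI pO by blast
    qed
    then show ?thesis using pI pO by auto
  qed
  have "H \<notin> components (-X)" if "H \<in> components (G - ?P)" for H
  proof -
    have "H \<subseteq> G - ?P" "H \<noteq> {}"
      using in_components_nonempty[OF that] in_components_subset[OF that] by auto
    then show ?thesis using components_nonoverlap[OF G(1), of H] G(5) by auto
  qed
  moreover have "G \<inter> ?I \<noteq> G \<inter> ?O" using pI(1) IO(2) by blast
  ultimately show thesis
    using that[of G "G \<inter> ?I" "G \<inter> ?O"] G(1) C comp by auto
qed

section \<open>Walks and paths\<close>

text \<open>A relation on ordered pairs, so that connectivity is its reflexive transitive closure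
  and the induction rules for closures apply.\<close>

definition adj :: "'a set set \<Rightarrow> ('a \<times> 'a) set" where
  "adj A = {(x, y). {x, y} \<in> A}"

lemma sym_adj: "sym (adj A)"
  by (auto simp: adj_def sym_def insert_commute)

lemma walk_edges_append:
  "p \<noteq> [] \<Longrightarrow> q \<noteq> [] \<Longrightarrow> walk_edges (p @ q) = walk_edges p \<union> walk_edges q \<union> {{last p, hd q}}"
  by (induction p rule: walk_edges.induct) (auto simp: neq_Nil_conv)

lemma walk_edges_rev: "walk_edges (rev p) = walk_edges p"
proof (induction p rule: walk_edges.induct)
  case (1 u v p)
  then show ?case
    using walk_edges_append[of "rev p @ [v]" "[u]"] by (simp add: insert_commute)
qed auto

lemma walk_edges_suffix: "walk_edges q \<subseteq> walk_edges (p @ q)"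
proof (induction p)
  case (Cons a p)
  then show ?case by (cases "p @ q") auto
qed simp

lemma walk_edges_subset_set: "e \<in> walk_edges p \<Longrightarrow> e \<subseteq> set p"
  by (induction p rule: walk_edges.induct) auto

lemma card_walk_edges: "distinct p \<Longrightarrow> finite (walk_edges p) \<and> card (walk_edges p) = length p - 1"
proof (induction p rule: walk_edges.induct)
  case (1 u v p)
  then have "{u, v} \<notin> walk_edges (v # p)" using walk_edges_subset_set by fastforce
  with 1 show ?case by auto
qed auto

lemma graph_path_suffix: "graph_path V E (as @ x # bs) \<Longrightarrow> graph_path V E (x # bs)"
  using walk_edges_suffix[of "x # bs" as] by (auto simp: graph_path_def)

lemma graph_path_Cons:
  "graph_path V E p \<Longrightarrow> x \<notin> set p \<Longrightarrow> x \<in> V \<Longrightarrow> {x, hd p} \<in> E \<Longrightarrow> graph_path V E (x # p)"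
  by (cases p) (auto simp: graph_path_def)

lemma graph_path_rev: "graph_path V E (rev p) = graph_path V E p"
  by (auto simp: graph_path_def walk_edges_rev)

lemma graph_path_mono: "graph_path V A p \<Longrightarrow> A \<subseteq> E \<Longrightarrow> graph_path V E p"
  by (auto simp: graph_path_def)

lemma rtrancl_adj_imp_path:
  assumes "(u, v) \<in> (adj A)\<^sup>*" "v \<in> V" "\<Union>A \<subseteq> V"
  obtains p where "graph_path V A p" "hd p = u" "last p = v"
proof -
  from assms(1) have "\<exists>p. graph_path V A p \<and> hd p = u \<and> last p = v"
  proof (induction rule: converse_rtrancl_induct)
    case base
    then show ?case using assms(2) by (intro exI[of _ "[v]"]) (simp add: graph_path_def)
  next
    case (step x y)
    then obtain p where p: "graph_path V A p" "hd p = y" "last p = v" by blast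
    show ?case
    proof (cases "x \<in> set p")
      \<comment> \<open>If \<open>x\<close> already lies on the path, the part before it is cut off
        instead of creating a repetition.\<close>
      case True
      then obtain as bs where "p = as @ x # bs" by (meson split_list)
      then show ?thesis
        using graph_path_suffix[of V A as x bs] p by (intro exI[of _ "x # bs"]) simp
    next
      case False
      moreover have "x \<in> V" "{x, y} \<in> A" using step(1) assms(3) by (auto simp: adj_def)
      ultimately show ?thesis
        using p graph_path_Cons[of V A p x] by (intro exI[of _ "x # p"]) (auto simp: graph_path_def)
    qed
  qed
  then show thesis using that by blast
qed

section \<open>Faces of plane graphs\<close>

locale plane_graph =
  fixes V :: "'a set" and E :: "'a set set" and pos :: "'a \<Rightarrow> complex"
    and \<gamma> :: "'a set \<Rightarrow> real \<Rightarrow> complex"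
  assumes simple: "simple_graph V E" and drawing: "plane_drawing V E pos \<gamma>"
begin

text \<open>All of \<open>V\<close> is drawn whatever \<open>A\<close> is. Adding an edge then adds
  only an arc, which meets the old set exactly in its two end points, and \<open>card V\<close>
  stays fixed in Euler's formula.\<close>

definition skeleton :: "'a set set \<Rightarrow> complex set" where
  "skeleton A = pos ` V \<union> (\<Union>e\<in>A. path_image (\<gamma> e))"

definition faces :: "'a set set \<Rightarrow> complex set set" where
  "faces A = components (- skeleton A)"

lemma edgeD:
  assumes "e \<in> E"
  shows "e \<subseteq> V" "card e = 2" "arc (\<gamma> e)" "{pathstart (\<gamma> e), pathfinish (\<gamma> e)} = pos ` e"
    "path_image (\<gamma> e) \<inter> pos ` V = pos ` e"
  using assms simple drawing by (auto simp: simple_graph_def plane_drawing_def)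

lemma finite_V: "finite V"
  using simple by (simp add: simple_graph_def)

lemma finite_E: "finite E"
  by (rule finite_subset[of _ "Pow V"]) (use finite_V edgeD(1) in auto)

lemma edge_Int_edge:
  "e \<in> E \<Longrightarrow> f \<in> E \<Longrightarrow> e \<noteq> f \<Longrightarrow> path_image (\<gamma> e) \<inter> path_image (\<gamma> f) = pos ` (e \<inter> f)"
  using drawing by (auto simp: plane_drawing_def)

lemma inj_pos: "inj_on pos V"
  using drawing by (simp add: plane_drawing_def)

lemma edge_Int_skeleton:
  assumes "e \<in> E" "A \<subseteq> E" "e \<notin> A"
  shows "path_image (\<gamma> e) \<inter> skeleton A = pos ` e"
proof -
  have "path_image (\<gamma> e) \<inter> path_image (\<gamma> f) \<subseteq> pos ` e" if "f \<in> A" for f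
    using edge_Int_edge[of e f] that assms by auto
  then show ?thesis using edgeD(5)[OF assms(1)] unfolding skeleton_def by blast
qed

lemma compact_skeleton: "A \<subseteq> E \<Longrightarrow> compact (skeleton A)"
  unfolding skeleton_def using finite_V finite_subset[OF _ finite_E, of A] edgeD(3)
  by (intro compact_Un compact_UN compact_arc_image finite_imp_compact finite_imageI) auto

text \<open>A drawing does not say at which end of the edge its arc starts; reversal provides either
  direction.\<close>

lemma edge_arc:
  assumes "{u, v} \<in> E"
  obtains d where "arc d" "pathstart d = pos u" "pathfinish d = pos v"
    "path_image d = path_image (\<gamma> {u, v})"
proof -
  let ?g = "\<gamma> {u, v}"
  have "{pathstart ?g, pathfinish ?g} = {pos u, pos v}" "arc ?g" using edgeD[OF assms] by auto
  then consider "pathstart ?g = pos u" "pathfinish ?g = pos v" | "pathstart ?g = pos v" "pathfinish ?g = pos u"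
    by (auto simp: doubleton_eq_iff)
  then show thesis
    by cases (use that[of ?g] that[of "reversepath ?g"] \<open>arc ?g\<close> in \<open>auto simp: arc_reversepath\<close>)
qed

lemma path_arc:
  assumes "graph_path V E p" "length p \<ge> 2"
  shows "\<exists>d. arc d \<and> pathstart d = pos (hd p) \<and> pathfinish d = pos (last p) \<and>
    path_image d \<subseteq> (\<Union>e\<in>walk_edges p. path_image (\<gamma> e))"
  using assms
proof (induction p rule: walk_edges.induct)
  case (1 u v p)
  then have uv: "{u, v} \<in> E" "u \<noteq> v" by (auto simp: graph_path_def)
  obtain d where d: "arc d" "pathstart d = pos u" "pathfinish d = pos v" "path_image d = path_image (\<gamma> {u, v})"
    using edge_arc uv(1) by blast
  show ?case
  proof (cases "p = []")
    case True
    then show ?thesis using d by auto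
  next
    case False
    have gp: "graph_path V E (v # p)" using 1(2) by (auto simp: graph_path_def)
    moreover have "length (v # p) \<ge> 2" using False by (cases p) auto
    ultimately obtain d' where d': "arc d'" "pathstart d' = pos v" "pathfinish d' = pos (last (v # p))"
      "path_image d' \<subseteq> (\<Union>e\<in>walk_edges (v # p). path_image (\<gamma> e))"
      using 1(1) by auto
    \<comment> \<open>Later edges avoid \<open>u\<close>, because the path does not return there, so
      they can touch the first arc only in \<open>pos v\<close>.\<close>
    have "path_image d \<inter> path_image (\<gamma> e) \<subseteq> {pos v}" if e: "e \<in> walk_edges (v # p)" for e
    proof -
      have "u \<notin> e" using walk_edges_subset_set[OF e] 1(2) by (auto simp: graph_path_def)
      moreover have "e \<in> E" using e gp by (auto simp: graph_path_def)
      moreover have "e \<noteq> {u, v}" using \<open>u \<notin> e\<close> by auto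
      ultimately show ?thesis using edge_Int_edge[OF uv(1)] d(4) by auto
    qed
    then have "path_image d \<inter> path_image d' \<subseteq> {pos v}" using d'(4) by blast
    then have "arc (d +++ d')" using d d' by (intro arc_join) auto
    moreover have "path_image (d +++ d') \<subseteq> (\<Union>e\<in>walk_edges (u # v # p). path_image (\<gamma> e))"
      using d d' by (auto simp: path_image_join)
    ultimately show ?thesis using d d' False by (intro exI[of _ "d +++ d'"]) auto
  qed
qed auto

section \<open>The effect of one new edge on the faces\<close>

lemma skeleton_insert: "skeleton (insert e A) = skeleton A \<union> path_image (\<gamma> e)"
  by (auto simp: skeleton_def)

text \<open>A path in \<open>A\<close> from \<open>v\<close> back to \<open>u\<close> is drawn as
  the arc inside the skeleton that \<open>attach_chord\<close> asks for.\<close>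

lemma faces_insert_chord:
  assumes e: "{u, v} \<in> E" "{u, v} \<notin> A" and A: "A \<subseteq> E" and conn: "(u, v) \<in> (adj A)\<^sup>*"
  obtains G H K where "G \<in> faces A" "H \<notin> faces A" "K \<notin> faces A" "H \<noteq> K"
    "faces (insert {u, v} A) = insert H (insert K (faces A - {G}))"
proof -
  have uv: "u \<in> V" "v \<in> V" "u \<noteq> v" using edgeD[OF e(1)] by auto
  have AV: "\<Union>A \<subseteq> V" using A edgeD(1) by auto
  obtain g where g: "arc g" "pathstart g = pos u" "pathfinish g = pos v" "path_image g = path_image (\<gamma> {u, v})"
    using edge_arc e(1) by blast
  have "(v, u) \<in> (adj A)\<^sup>*" using conn sym_adj sym_rtrancl symD by metis
  then obtain p where p: "graph_path V A p" "hd p = v" "last p = u"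
    using rtrancl_adj_imp_path uv(1) AV by metis
  have "length p \<ge> 2" using p uv(3) by (cases p rule: walk_edges.cases) (auto simp: graph_path_def)
  then obtain d where d: "arc d" "pathstart d = pos v" "pathfinish d = pos u"
    "path_image d \<subseteq> (\<Union>e\<in>walk_edges p. path_image (\<gamma> e))"
    using path_arc[OF graph_path_mono[OF p(1) A]] p by auto
  have dX: "path_image d \<subseteq> skeleton A" using d(4) p(1) by (force simp: skeleton_def graph_path_def)
  have gX: "path_image g \<inter> skeleton A = {pathstart g, pathfinish g}"
    using edge_Int_skeleton[OF e(1) A e(2)] g by simp
  show thesis
    using attach_chord[OF compact_skeleton[OF A] g(1) gX d(1) dX] d(2,3) that
    unfolding faces_def skeleton_insert g(2-4)[symmetric] by blast
qed

lemma faces_insert_bridge: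
  assumes e: "{u, v} \<in> E" "{u, v} \<notin> A" and A: "A \<subseteq> E" and nconn: "(u, v) \<notin> (adj A)\<^sup>*"
  obtains G H where "G \<in> faces A" "H \<notin> faces A"
    "faces (insert {u, v} A) = insert H (faces A - {G})"
proof -
  have uv: "u \<in> V" "v \<in> V" "u \<noteq> v" using edgeD[OF e(1)] by auto
  define W where "W = {w \<in> V. (u, w) \<in> (adj A)\<^sup>*}"
  \<comment> \<open>\<open>X U\<close> is the drawing of the subgraph induced by \<open>U\<close>.
    The skeleton splits into the part of the component \<open>W\<close> of \<open>u\<close> and the
    rest, which are disjoint compact sets joined by the new arc.\<close>
  define X where "X W = pos ` W \<union> (\<Union>f\<in>{f \<in> A. f \<subseteq> W}. path_image (\<gamma> f))" for W
  have W: "W \<subseteq> V" "u \<in> W" "v \<notin> W" using uv nconn by (auto simp: W_def)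
  have side: "f \<subseteq> W \<or> f \<subseteq> V - W" if "f \<in> A" for f
  proof -
    have "card f = 2" using edgeD(2) A that by blast
    then obtain x y where f: "f = {x, y}" by (meson card_2_iff)
    then have "(x, y) \<in> adj A" "(y, x) \<in> adj A" using that by (auto simp: adj_def insert_commute)
    moreover have "x \<in> V" "y \<in> V" using edgeD(1) A that f by auto
    ultimately show ?thesis unfolding W_def f by (auto intro: rtrancl_into_rtrancl)
  qed
  have skel: "skeleton A = X W \<union> X (V - W)"
    unfolding skeleton_def X_def using side W(1) by blast
  have comp: "compact (X U)" if "U \<subseteq> V" for U
    unfolding X_def
    using finite_subset[OF that finite_V] finite_subset[OF A finite_E] edgeD(3) A that
    by (intro compact_Un compact_UN compact_arc_image finite_imp_compact finite_imageI) auto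
  have vert: "path_image (\<gamma> f) \<inter> pos ` U = pos ` (f \<inter> U)" if "f \<in> E" "U \<subseteq> V" for f U
  proof -
    have "path_image (\<gamma> f) \<inter> pos ` U = pos ` f \<inter> pos ` U" using edgeD(5)[OF that(1)] that(2) by blast
    then show ?thesis using inj_on_image_Int[OF inj_pos edgeD(1)[OF that(1)] that(2)] by simp
  qed
  \<comment> \<open>Either alternative ensures that \<open>f\<close> is not itself among the edges
    drawn in \<open>X U\<close>, so only common end points remain. The first serves the new edge,
    the second the edges on the other side.\<close>
  have XX: "path_image (\<gamma> f) \<inter> X U = pos ` (f \<inter> U)" if "f \<in> E" "f \<notin> A \<or> f \<inter> U = {}" "U \<subseteq> V" for f U
  proof -
    have "path_image (\<gamma> f) \<inter> path_image (\<gamma> h) \<subseteq> pos ` (f \<inter> U)" if h: "h \<in> A" "h \<subseteq> U" for h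
    proof -
      have "h \<noteq> {}" using edgeD(2)[of h] h A by auto
      then have "f \<noteq> h" using h \<open>f \<notin> A \<or> _\<close> by auto
      then have "path_image (\<gamma> f) \<inter> path_image (\<gamma> h) = pos ` (f \<inter> h)"
        using edge_Int_edge[of f h] \<open>f \<in> E\<close> h A by auto
      then show ?thesis using h by auto
    qed
    then show ?thesis using vert[OF that(1,3)] unfolding X_def by blast
  qed
  have disj: "X W \<inter> X (V - W) = {}"
  proof -
    have 1: "pos ` W \<inter> pos ` (V - W) = {}" using inj_pos W(1) by (auto simp: inj_on_def)
    have 2: "path_image (\<gamma> f) \<inter> pos ` W = {}" if "f \<in> A" "f \<subseteq> V - W" for f
    proof -
      have "f \<inter> W = {}" using that by auto
      then show ?thesis using vert[of f W] that A W(1) by (simp add: Int_commute subset_iff)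
    qed
    have 3: "path_image (\<gamma> f) \<inter> X (V - W) = {}" if f: "f \<in> A" "f \<subseteq> W" for f
    proof -
      have "f \<inter> (V - W) = {}" using f by auto
      then show ?thesis using XX[of f "V - W"] f A by auto
    qed
    have "z \<notin> X (V - W)" if "z \<in> X W" for z
    proof (cases "z \<in> pos ` W")
      case True
      moreover have "z \<notin> path_image (\<gamma> f)" if "f \<in> A" "f \<subseteq> V - W" for f
        using 2[OF that] True by blast
      ultimately show ?thesis using 1 by (auto simp: X_def)
    next
      case False
      then obtain f where "f \<in> A" "f \<subseteq> W" "z \<in> path_image (\<gamma> f)"
        using \<open>z \<in> X W\<close> by (auto simp: X_def)
      then show ?thesis using 3 by blast
    qed
    then show ?thesis by blast
  qed
  obtain g where g: "arc g" "pathstart g = pos u" "pathfinish g = pos v" "path_image g = path_image (\<gamma> {u, v})"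
    using edge_arc e(1) by blast
  have "{u, v} \<inter> W = {u}" "{u, v} \<inter> (V - W) = {v}" using W uv by auto
  then have "path_image g \<inter> X W = {pathstart g}" "path_image g \<inter> X (V - W) = {pathfinish g}"
    using XX[OF e(1), of W] XX[OF e(1), of "V - W"] W(1) e(2) g by auto
  then show thesis
    using attach_bridge[OF comp[OF W(1)] comp[OF Diff_subset] disj g(1)] that
    unfolding faces_def skeleton_insert skel g(4)[symmetric] by blast
qed

section \<open>Euler's formula\<close>

lemma faces_empty: "card (faces {}) = 1"
proof -
  have "connected (- (pos ` V))"
    by (intro path_connected_imp_connected path_connected_complement_countable)
      (use finite_V in \<open>auto intro: countable_finite\<close>)
  moreover have "- (pos ` V) \<noteq> {}"
    using finite_V infinite_UNIV_char_0[where 'a = complex] by (metis Compl_empty_eq finite_imageI double_complement)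
  ultimately have "faces {} = {- (pos ` V)}"
    unfolding faces_def skeleton_def by (simp add: components_eq_sing_iff)
  then show ?thesis by simp
qed

lemma edge_obtain:
  assumes "e \<in> E"
  obtains u v where "e = {u, v}" "u \<in> V" "v \<in> V" "u \<noteq> v"
proof -
  obtain u v where "e = {u, v}" "u \<noteq> v" using edgeD(2)[OF assms] by (meson card_2_iff)
  then show thesis using that edgeD(1)[OF assms] by auto
qed

lemma Union_edges: "A \<subseteq> E \<Longrightarrow> \<Union>A \<subseteq> V"
  using edgeD(1) by blast

text \<open>Here \<open>card (f ` V)\<close> is the number of components of the graph \<open>(V, A)\<close>.\<close>
lemma euler:
  assumes "A \<subseteq> E"
  shows "\<exists>f :: 'a \<Rightarrow> 'a. (\<forall>a\<in>V. \<forall>b\<in>V. f a = f b \<longleftrightarrow> (a, b) \<in> (adj A)\<^sup>*) \<and> finite (faces A) \<and>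
    card (faces A) + card V = 1 + card A + card (f ` V)"
  using finite_subset[OF assms finite_E] assms
proof (induction A rule: finite_induct)
  case empty
  have "finite (faces {})" using faces_empty card.infinite by fastforce
  then show ?case using faces_empty by (intro exI[of _ id]) (auto simp: adj_def)
next
  case (insert e A)
  let ?A = "insert e A"
  have A: "A \<subseteq> E" and e: "e \<in> E" using insert.prems by auto
  from insert.IH[OF A] obtain f :: "'a \<Rightarrow> 'a" where
    f: "\<And>a b. a \<in> V \<Longrightarrow> b \<in> V \<Longrightarrow> f a = f b \<longleftrightarrow> (a, b) \<in> (adj A)\<^sup>*"
    and fin: "finite (faces A)" and cnt: "card (faces A) + card V = 1 + card A + card (f ` V)"
    by blast
  obtain u v where uv: "e = {u, v}" "u \<in> V" "v \<in> V" "u \<noteq> v" using edge_obtain[OF e] by blast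
  have adj: "adj ?A = adj A \<union> {(u, v), (v, u)}"
    by (auto simp: adj_def uv doubleton_eq_iff)
  have mono: "(adj A)\<^sup>* \<subseteq> (adj ?A)\<^sup>*" by (rule rtrancl_mono) (auto simp: adj)
  show ?case
  proof (cases "(u, v) \<in> (adj A)\<^sup>*")
    case True
    \<comment> \<open>Connectivity is unchanged by an edge within a component, so the old labelling
      \<open>f\<close> is kept and the face count rises with the edge count.\<close>
    then have "(v, u) \<in> (adj A)\<^sup>*" using sym_rtrancl[OF sym_adj] symD by metis
    then have "adj ?A \<subseteq> (adj A)\<^sup>*" using True by (auto simp: adj)
    then have eq: "(adj ?A)\<^sup>* = (adj A)\<^sup>*" by (intro rtrancl_subset) (auto simp: adj)
    obtain G H K where GHK: "G \<in> faces A" "H \<notin> faces A" "K \<notin> faces A" "H \<noteq> K"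
      "faces ?A = insert H (insert K (faces A - {G}))"
      using faces_insert_chord[of u v A] True A e insert.hyps(2) uv(1) by metis
    have "card (faces A - {G}) + 1 = card (faces A)"
      using GHK(1) fin by (metis Suc_eq_plus1 card_Suc_Diff1)
    then have "card (faces ?A) = card (faces A) + 1" "finite (faces ?A)"
      using GHK fin by auto
    then show ?thesis
      using f cnt insert.hyps by (intro exI[of _ f]) (auto simp: eq)
  next
    case False
    obtain G H where GH: "G \<in> faces A" "H \<notin> faces A" "faces ?A = insert H (faces A - {G})"
      using faces_insert_bridge[of u v A] False A e insert.hyps(2) uv(1) by metis
    have "card (faces A - {G}) + 1 = card (faces A)"
      using GH(1) fin by (metis Suc_eq_plus1 card_Suc_Diff1)
    then have fc: "card (faces ?A) = card (faces A)" "finite (faces ?A)"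
      using GH fin by auto
    have fne: "f u \<noteq> f v" using f uv False by blast
    \<comment> \<open>\<open>f\<close> labels the components. The new edge merges those of
      \<open>u\<close> and \<open>v\<close>, so the label of \<open>u\<close> is replaced by that of
      \<open>v\<close> and exactly one label disappears.\<close>
    define g where "g w = (if f w = f u then f v else f w)" for w
    have "g ` V = f ` V - {f u}" using uv fne by (auto simp: g_def image_iff)
    then have card: "card (g ` V) + 1 = card (f ` V)"
      using uv(2) finite_V card_Suc_Diff1[of "f ` V" "f u"] by simp
    have uv': "(u, v) \<in> (adj ?A)\<^sup>*" "(v, u) \<in> (adj ?A)\<^sup>*" by (auto simp: adj)
    have tr: "(a, b) \<in> (adj ?A)\<^sup>*" if "f a = f b" "a \<in> V" "b \<in> V" for a b
      using f mono that by blast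
    have "(a, b) \<in> (adj ?A)\<^sup>*" if ab: "a \<in> V" "b \<in> V" "g a = g b" for a b
    proof -
      consider "f a = f b" | "f a = f u" "f b = f v" | "f a = f v" "f b = f u"
        using ab by (auto simp: g_def split: if_splits)
      then show ?thesis
      proof cases
        case 1
        then show ?thesis using tr ab by blast
      next
        case 2
        then have "(a, u) \<in> (adj ?A)\<^sup>*" "(v, b) \<in> (adj ?A)\<^sup>*" using tr ab uv by auto
        then show ?thesis using uv' by (meson rtrancl_trans)
      next
        case 3
        then have "(a, v) \<in> (adj ?A)\<^sup>*" "(u, b) \<in> (adj ?A)\<^sup>*" using tr ab uv by auto
        then show ?thesis using uv' by (meson rtrancl_trans)
      qed
    qed
    moreover have "g a = g b" if "(a, b) \<in> (adj ?A)\<^sup>*" for a b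
      using that
    proof (induction rule: rtrancl_induct)
      case (step b c)
      from step(2) consider "(b, c) \<in> adj A" | "b = u" "c = v" | "b = v" "c = u" by (auto simp: adj)
      then have "g b = g c"
      proof cases
        case 1
        then have "b \<in> V" "c \<in> V" using Union_edges[OF A] by (auto simp: adj_def)
        then have "f b = f c" using f 1 by blast
        then show ?thesis by (simp add: g_def)
      qed (use fne in \<open>auto simp: g_def\<close>)
      then show ?case using step by simp
    qed simp
    ultimately have "\<forall>a\<in>V. \<forall>b\<in>V. g a = g b \<longleftrightarrow> (a, b) \<in> (adj ?A)\<^sup>*" by blast
    then show ?thesis
      using fc cnt card insert.hyps by (intro exI[of _ g]) auto
  qed
qed

section \<open>Edges at a face and the bound on the number of edges\<close>

text \<open>The faces destroyed by deleting \<open>e\<close> are those created by putting it back: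
  at most two for a chord and one for a bridge.\<close>

lemma card_faces_at_edge:
  assumes "e \<in> E"
  shows "card (faces E - faces (E - {e})) \<le> 2"
proof -
  obtain u v where uv: "e = {u, v}" using edge_obtain[OF assms] by metis
  have E: "insert {u, v} (E - {e}) = E" "{u, v} \<in> E" "{u, v} \<notin> E - {e}" "E - {e} \<subseteq> E"
    using assms uv by auto
  have "\<exists>H K. faces E - faces (E - {e}) \<subseteq> {H, K}"
  proof (cases "(u, v) \<in> (adj (E - {e}))\<^sup>*")
    case True
    then obtain G H K where "faces E = insert H (insert K (faces (E - {e}) - {G}))"
      using faces_insert_chord[OF E(2,3,4)] E(1) by metis
    then show ?thesis by blast
  next
    case False
    then obtain G H where "faces E = insert H (faces (E - {e}) - {G})"
      using faces_insert_bridge[OF E(2,3,4)] E(1) by metis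
    then show ?thesis by blast
  qed
  then obtain H K where "faces E - faces (E - {e}) \<subseteq> {H, K}" by blast
  then have "card (faces E - faces (E - {e})) \<le> card {H, K}" by (intro card_mono) auto
  also have "\<dots> \<le> 2" by (simp add: card_insert_if)
  finally show ?thesis .
qed

text \<open>The frontier of \<open>f\<close> is covered by the vertices and the edges whose deletion
  destroys \<open>f\<close>. A larger connected set avoiding these would have to cross the frontier,
  so \<open>f\<close> is still maximal.\<close>

lemma face_of_boundary:
  assumes f: "f \<in> faces E"
  shows "f \<in> faces {e \<in> E. f \<notin> faces (E - {e})}"
proof -
  let ?B = "{e \<in> E. f \<notin> faces (E - {e})}"
  have closed: "closed (skeleton A)" if "A \<subseteq> E" for A
    using compact_skeleton[OF that] by (rule compact_imp_closed)
  have fr: "frontier f \<subseteq> skeleton A" if "f \<in> faces A" "A \<subseteq> E" for A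
    using frontier_of_components_closed_complement closed[OF that(2)] that(1) unfolding faces_def by blast
  have "frontier f \<subseteq> skeleton ?B"
  proof
    fix z assume z: "z \<in> frontier f"
    show "z \<in> skeleton ?B"
    proof (rule ccontr)
      assume nz: "z \<notin> skeleton ?B"
      have "z \<in> skeleton E" using fr[OF f] z by auto
      then obtain e where e: "e \<in> E" "z \<in> path_image (\<gamma> e)" using nz by (auto simp: skeleton_def)
      then have "e \<notin> ?B" using nz by (auto simp: skeleton_def)
      \<comment> \<open>Deleting \<open>e\<close> keeps \<open>f\<close>, so the frontier lies in
        the skeleton without \<open>e\<close>. The arc of \<open>e\<close> meets that skeleton only
        in its end points, hence \<open>z\<close> is a vertex.\<close>
      then have "f \<in> faces (E - {e})" using e by auto
      then have "z \<in> skeleton (E - {e})" using fr z by auto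
      then have "z \<in> pos ` e"
        using edge_Int_skeleton[OF e(1), of "E - {e}"] e(2) by auto
      then show False using nz edgeD(1)[OF e(1)] by (auto simp: skeleton_def)
    qed
  qed
  moreover have sub: "skeleton ?B \<subseteq> skeleton E" by (auto simp: skeleton_def)
  moreover have "f \<noteq> {}" "f \<subseteq> - skeleton E" "connected f"
    using f in_components_nonempty in_components_subset in_components_connected
    unfolding faces_def by blast+
  moreover have "d = f" if "f \<subseteq> d" "d \<subseteq> - skeleton ?B" "connected d" for d
  proof (rule ccontr)
    assume "d \<noteq> f"
    then have "d \<inter> frontier f \<noteq> {}"
      using that \<open>f \<noteq> {}\<close> by (intro connected_Int_frontier) auto
    then show False using that \<open>frontier f \<subseteq> _\<close> by blast
  qed
  ultimately show ?thesis unfolding faces_def in_components_maximal by blast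
qed

text \<open>At most \<open>k\<close> edges contain no cycle, so every edge is a bridge when it is
  added, and the number of faces stays at its initial value 1.\<close>

lemma card_faces_few_edges:
  assumes girth: "\<And>c. graph_cycle V E c \<Longrightarrow> k < length c"
    and "A \<subseteq> E" "card A \<le> k"
  shows "card (faces A) = 1"
  using finite_subset[OF assms(2) finite_E] assms(2,3)
proof (induction A rule: finite_induct)
  case empty
  then show ?case using faces_empty by simp
next
  case (insert e A)
  have A: "A \<subseteq> E" and e: "e \<in> E" using insert.prems by auto
  obtain u v where uv: "e = {u, v}" "u \<in> V" "v \<in> V" "u \<noteq> v" using edge_obtain[OF e] by blast
  have "(u, v) \<notin> (adj A)\<^sup>*"
  proof
    assume "(u, v) \<in> (adj A)\<^sup>*"
    then obtain p where p: "graph_path V A p" "hd p = u" "last p = v"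
      using rtrancl_adj_imp_path uv(3) Union_edges[OF A] by metis
    \<comment> \<open>A shorter path would be a single vertex, against \<open>u\<close> and
      \<open>v\<close> being distinct, or the edge \<open>e\<close>, which is not in
      \<open>A\<close>.\<close>
    have "length p \<ge> 3"
    proof (rule ccontr)
      assume "\<not> length p \<ge> 3"
      moreover have "p \<noteq> []" using p(1) by (simp add: graph_path_def)
      ultimately consider x where "p = [x]" | x y where "p = [x, y]"
        by (cases p; cases "tl p"; cases "tl (tl p)") auto
      then show False
        by cases (use p uv insert.hyps in \<open>auto simp: graph_path_def\<close>)
    qed
    then have "graph_cycle V E p"
      using graph_path_mono[OF p(1) A] p e uv(1) by (auto simp: graph_cycle_def insert_commute)
    then have "k < length p" by (rule girth)
    \<comment> \<open>The path has \<open>length p - 1\<close> edges in \<open>A\<close>, and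
      \<open>A\<close> has at most \<open>k - 1\<close> edges, one being spent on
      \<open>e\<close>.\<close>
    moreover have "length p - 1 \<le> card A"
      using p(1) card_walk_edges[of p] insert.hyps(1) by (metis card_mono graph_path_def)
    ultimately show False using insert by simp
  qed
  then obtain G H where GH: "G \<in> faces A" "H \<notin> faces A" "faces (insert e A) = insert H (faces A - {G})"
    using faces_insert_bridge[of u v A] A e insert.hyps(2) uv(1) by metis
  have "card (faces A) = 1" using insert A by simp
  then have "faces A = {G}" using GH(1) by (auto simp: card_1_singleton_iff)
  then show ?case using GH by simp
qed

lemma edge_bound:
  assumes girth: "\<And>c. graph_cycle V E c \<Longrightarrow> 6 \<le> length c" and "V \<noteq> {}"
  shows "2 * card E + 3 \<le> 3 * card V"
proof -
  obtain f :: "'a \<Rightarrow> 'a" where fin: "finite (faces E)"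
    and cnt: "card (faces E) + card V = 1 + card E + card (f ` V)"
    using euler[of E] by blast
  have k: "card (f ` V) \<ge> 1" using finite_V assms(2) by (simp add: Suc_leI card_gt_0_iff)
  show ?thesis
  proof (cases "card (faces E) \<le> 1")
    \<comment> \<open>A single face may have fewer than six edges, so this case comes from Euler's
      formula alone, which gives \<open>card E < card V\<close>. The constant 3 is attained here, by
      a single vertex.\<close>
    case True
    then show ?thesis using cnt k by linarith
  next
    case False
    define B where "B F = {e \<in> E. F \<notin> faces (E - {e})}" for F
    have "6 \<le> card (B F)" if F: "F \<in> faces E" for F
    proof (rule ccontr)
      assume "\<not> 6 \<le> card (B F)"
      \<comment> \<open>With at most five edges at \<open>F\<close>, the subgraph formed by them has
        \<open>F\<close> as its only face. Then \<open>F\<close> contains the whole complement of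
        the drawing and is the only face of \<open>E\<close>.\<close>
      then have "card (faces (B F)) = 1"
        using girth by (intro card_faces_few_edges[of 5]) (fastforce simp: B_def)+
      moreover have "F \<in> faces (B F)" using face_of_boundary[OF F] by (simp add: B_def)
      ultimately have "faces (B F) = {F}" by (auto simp: card_1_singleton_iff)
      then have "- skeleton (B F) = F"
        unfolding faces_def by (metis Union_components ccpo_Sup_singleton)
      moreover have "skeleton (B F) \<subseteq> skeleton E" by (auto simp: skeleton_def B_def)
      ultimately have sub: "- skeleton E \<subseteq> F" by auto
      have "F' = F" if F': "F' \<in> faces E" for F'
      proof -
        have "F' \<noteq> {}" "F' \<subseteq> F"
          using F' sub in_components_nonempty in_components_subset unfolding faces_def by blast+
        then show ?thesis using components_nonoverlap F F' unfolding faces_def by blast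
      qed
      then have "faces E \<subseteq> {F}" by auto
      then have "card (faces E) \<le> card {F}" by (intro card_mono) auto
      then show False using False by simp
    qed
    then have "(\<Sum>F\<in>faces E. 6) \<le> (\<Sum>F\<in>faces E. card (B F))" by (intro sum_mono) auto
    also have "\<dots> = (\<Sum>F\<in>faces E. \<Sum>e\<in>{e\<in>E. F \<notin> faces (E - {e})}. 1)" by (simp add: B_def)
    \<comment> \<open>The pairs of a face and an edge at it are now counted edge by edge.\<close>
    also have "\<dots> = (\<Sum>e\<in>E. \<Sum>F\<in>{F\<in>faces E. F \<notin> faces (E - {e})}. 1)"
      using fin finite_E by (rule sum.swap_restrict)
    also have "\<dots> \<le> (\<Sum>e\<in>E. 2)"
      using card_faces_at_edge by (intro sum_mono) (simp add: set_diff_eq)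
    finally have "6 * card (faces E) \<le> 2 * card E" by (simp add: mult.commute)
    then show ?thesis using cnt k by linarith
  qed
qed

end

section \<open>Pairs of vertices of low degree\<close>

lemma simple_graph_finite_edges: "simple_graph V E \<Longrightarrow> finite E"
  unfolding simple_graph_def by (rule finite_subset[of _ "Pow V"]) auto

lemma handshake:
  assumes "simple_graph V E"
  shows "(\<Sum>v\<in>V. degree E v) = 2 * card E"
proof -
  have "(\<Sum>v\<in>V. degree E v) = (\<Sum>v\<in>V. \<Sum>e\<in>{e\<in>E. v \<in> e}. 1)" by (simp add: degree_def)
  also have "\<dots> = (\<Sum>e\<in>E. \<Sum>v\<in>{v\<in>V. v \<in> e}. 1)"
    by (rule sum.swap_restrict)
      (use assms simple_graph_finite_edges in \<open>auto simp: simple_graph_def\<close>)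
  also have "\<dots> = (\<Sum>e\<in>E. 2)"
  proof (rule sum.cong)
    fix e assume "e \<in> E"
    then have "{v\<in>V. v \<in> e} = e" "card e = 2" using assms by (auto simp: simple_graph_def)
    then show "(\<Sum>v\<in>{v\<in>V. v \<in> e}. 1) = (2::nat)" by simp
  qed simp
  finally show ?thesis by simp
qed

text \<open>If all vertices but \<open>w\<close> have degree at least 3, the degree sum is at least
  \<open>3 * (card V - 1) + 1\<close>, where the last 1 is the positive degree of \<open>w\<close>.
  This exceeds the bound \<open>3 * card V - 3\<close> on \<open>2 * card E\<close> by just
  one.\<close>

lemma (in plane_graph) low_degree_pair_of_component:
  assumes girth: "\<And>c. graph_cycle V E c \<Longrightarrow> 6 \<le> length c" and "V \<noteq> {}"
    and pos: "\<And>v. v \<in> V \<Longrightarrow> 0 < degree E v"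
  obtains u v where "u \<in> V" "v \<in> V" "u \<noteq> v" "degree E u \<le> 2" "degree E v \<le> 2"
proof (rule ccontr)
  assume nt: "\<not> thesis"
  note found = that
  have uniq: "u = v" if "u \<in> V" "v \<in> V" "degree E u \<le> 2" "degree E v \<le> 2" for u v
    using nt found that by blast
  obtain w where w: "w \<in> V" "\<And>v. v \<in> V - {w} \<Longrightarrow> 3 \<le> degree E v"
  proof (cases "\<exists>w\<in>V. degree E w \<le> 2")
    case True
    then obtain w where w: "w \<in> V" "degree E w \<le> 2" by blast
    have "3 \<le> degree E v" if "v \<in> V - {w}" for v
      using uniq[of v w] w that by force
    then show thesis using that[of w] w by blast
  next
    case False
    then have "3 \<le> degree E v" if "v \<in> V" for v using that by force
    then show thesis using \<open>V \<noteq> {}\<close> that by blast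
  qed
  have "3 * card (V - {w}) \<le> (\<Sum>v\<in>V - {w}. degree E v)"
    using sum_mono[of "V - {w}" "\<lambda>_. 3" "degree E"] w(2) by simp
  moreover have "(\<Sum>v\<in>V. degree E v) = degree E w + (\<Sum>v\<in>V - {w}. degree E v)"
    using finite_V w(1) by (rule sum.remove)
  moreover have "card V = Suc (card (V - {w}))" using finite_V w(1) by (rule card.remove)
  ultimately show False
    using handshake[OF simple] pos[OF w(1)] edge_bound[OF girth \<open>V \<noteq> {}\<close>] by simp
qed

lemma low_degree_pair:
  assumes simple: "simple_graph V E" and "planar V E"
    and girth: "\<And>c. graph_cycle V E c \<Longrightarrow> 6 \<le> length c" and "E \<noteq> {}"
  obtains u v where "u \<in> V" "v \<in> V" "u \<noteq> v" "(u, v) \<in> (adj E)\<^sup>*"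
    "0 < degree E u" "degree E u \<le> 2" "0 < degree E v" "degree E v \<le> 2"
proof -
  obtain ps \<gamma> where dr: "plane_drawing V E ps \<gamma>" using assms(2) by (auto simp: planar_def)
  obtain e\<^sub>0 where e0: "e\<^sub>0 \<in> E" using \<open>E \<noteq> {}\<close> by blast
  then have "card e\<^sub>0 = 2" "e\<^sub>0 \<subseteq> V" using simple by (auto simp: simple_graph_def)
  moreover then have "e\<^sub>0 \<noteq> {}" by auto
  ultimately obtain a where a: "a \<in> e\<^sub>0" "a \<in> V" by blast
  \<comment> \<open>\<open>W\<close> is the component of an end of some edge and \<open>F\<close>
    its edge set. Every edge at a vertex of \<open>W\<close> lies in \<open>F\<close>, so degrees do
    not change, and all of them are positive.\<close>
  define W where "W = {w \<in> V. (a, w) \<in> (adj E)\<^sup>*}"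
  define F where "F = {e \<in> E. e \<subseteq> W}"
  have inc: "e \<in> F" if "w \<in> W" "e \<in> E" "w \<in> e" for w e
  proof -
    have "card e = 2" "e \<subseteq> V" using simple that by (auto simp: simple_graph_def)
    then obtain x where x: "e = {w, x}" using \<open>w \<in> e\<close>
      by (metis card_2_iff doubleton_eq_iff insert_iff singletonD)
    then have "(w, x) \<in> adj E" using that by (simp add: adj_def)
    then have "x \<in> W" using \<open>w \<in> W\<close> \<open>e \<subseteq> V\<close> x by (auto simp: W_def intro: rtrancl_into_rtrancl)
    then show ?thesis using that x by (simp add: F_def)
  qed
  have deg: "degree F w = degree E w" if "w \<in> W" for w
  proof -
    have "{e \<in> F. w \<in> e} = {e \<in> E. w \<in> e}" using inc[OF that] by (auto simp: F_def)
    then show ?thesis by (simp add: degree_def)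
  qed
  have finE: "finite E" using simple_graph_finite_edges[OF simple] .
  have pos: "0 < degree E w" if "w \<in> W" for w
  proof -
    have "\<exists>e\<in>E. w \<in> e"
    proof (cases "w = a")
      case True
      then show ?thesis using a e0 by blast
    next
      case False
      have "(a, w) \<in> (adj E)\<^sup>*" using that by (simp add: W_def)
      then obtain x where "(x, w) \<in> adj E" using False by (auto elim: rtranclE)
      then show ?thesis by (auto simp: adj_def)
    qed
    then show ?thesis using finE by (auto simp: degree_def card_gt_0_iff)
  qed
  have WV: "W \<subseteq> V" and FE: "F \<subseteq> E" by (auto simp: W_def F_def)
  interpret H: plane_graph W F ps \<gamma>
  proof
    show "simple_graph W F"
      using simple WV by (auto simp: simple_graph_def F_def intro: finite_subset)
    have "path_image (\<gamma> e) \<inter> ps ` W = ps ` e" if "e \<in> F" for e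
    proof -
      have "path_image (\<gamma> e) \<inter> ps ` V = ps ` e" "e \<subseteq> W"
        using dr that by (auto simp: plane_drawing_def F_def)
      then show ?thesis using WV by blast
    qed
    then show "plane_drawing W F ps \<gamma>"
      using dr FE WV unfolding plane_drawing_def by (meson inj_on_subset subsetD)
  qed
  have "6 \<le> length c" if "graph_cycle W F c" for c
    using that FE WV by (intro girth) (auto simp: graph_cycle_def graph_path_def)
  moreover have "W \<noteq> {}" using a by (auto simp: W_def)
  ultimately obtain u v where uv: "u \<in> W" "v \<in> W" "u \<noteq> v" "degree F u \<le> 2" "degree F v \<le> 2"
    using H.low_degree_pair_of_component pos deg by metis
  have "(u, a) \<in> (adj E)\<^sup>*" "(a, v) \<in> (adj E)\<^sup>*"
    using uv sym_rtrancl[OF sym_adj, of E] by (auto simp: W_def dest: symD)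
  then have "(u, v) \<in> (adj E)\<^sup>*" by (rule rtrancl_trans)
  then show thesis using that[of u v] uv pos deg WV by auto
qed

section \<open>A path using all edges at two vertices of low degree\<close>

text \<open>An unused edge at the first vertex has its other end off the path, as a chord would yield a
  shorter path.\<close>
lemma shortest_path_prolong:
  assumes simple: "simple_graph V E" and p: "graph_path V E p" and "hd p \<noteq> last p"
    and shortest: "\<And>q. graph_path V E q \<Longrightarrow> hd q = hd p \<Longrightarrow> last q = last p \<Longrightarrow> length p \<le> length q"
    and deg: "degree E (hd p) \<le> 2"
  obtains l where "l = [] \<or> (\<exists>x. l = [x] \<and> x \<in> V \<and> x \<notin> set p \<and> {x, hd p} \<in> E)"
    "\<And>e. e \<in> E \<Longrightarrow> hd p \<in> e \<Longrightarrow> e \<in> walk_edges (l @ p)"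
proof (cases "\<forall>e\<in>E. hd p \<in> e \<longrightarrow> e \<in> walk_edges p")
  case True
  then show thesis using that[of "[]"] by auto
next
  case False
  then obtain e where e: "e \<in> E" "hd p \<in> e" "e \<notin> walk_edges p" by blast
  obtain u w bs where upw: "p = u # w # bs"
    using assms(3) p by (cases p rule: walk_edges.cases) (auto simp: graph_path_def)
  have "card e = 2" "e \<subseteq> V" using simple e(1) by (auto simp: simple_graph_def)
  then obtain x where x: "e = {x, u}" "x \<noteq> u" using \<open>hd p \<in> e\<close> upw
    by (metis card_2_iff doubleton_eq_iff insert_iff list.sel(1) singletonD)
  have uw: "{u, w} \<in> E" "{u, w} \<noteq> e" using p e upw by (auto simp: graph_path_def)
  \<comment> \<open>The first edge of the path and \<open>e\<close> already exhaust the degree of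
    \<open>u\<close>.\<close>
  have "{e, {u, w}} = {e \<in> E. u \<in> e}"
  proof (rule card_seteq)
    show "finite {e \<in> E. u \<in> e}" using simple_graph_finite_edges[OF simple] by simp
    show "card {e \<in> E. u \<in> e} \<le> card {e, {u, w}}" using deg upw uw by (simp add: degree_def)
  qed (use e uw x in auto)
  then have all: "e' \<in> {e, {u, w}}" if "e' \<in> E" "u \<in> e'" for e' using that by blast
  have "x \<notin> set p"
  proof
    assume "x \<in> set p"
    \<comment> \<open>So the shortcut through \<open>e\<close> skips at least the vertex
      \<open>w\<close> and is strictly shorter.\<close>
    moreover have "x \<noteq> w" using uw x by auto
    ultimately obtain as cs where bs: "bs = as @ x # cs"
      using upw x(2) by (metis set_ConsD split_list)
    then have "graph_path V E (x # cs)" using graph_path_suffix[of V E "u # w # as"] p upw by simp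
    moreover have "u \<notin> set (x # cs)" "u \<in> V" using p upw bs by (auto simp: graph_path_def)
    ultimately have "graph_path V E (u # x # cs)"
      using e(1) x(1) \<open>graph_path V E (x # cs)\<close> graph_path_Cons[of V E "x # cs" u]
      by (simp add: insert_commute)
    then have "length p \<le> length (u # x # cs)" using upw bs by (intro shortest) auto
    then show False using upw bs by simp
  qed
  then show thesis
    using that[of "[x]"] x e all upw \<open>e \<subseteq> V\<close> by (auto simp: insert_commute)
qed

text \<open>A shortest path from \<open>u\<close> to \<open>v\<close> is prolonged at both ends; the
  end \<open>v\<close> is treated as the start of the reversed path.\<close>

lemma path_through_low_degree_pair:
  assumes simple: "simple_graph V E" and girth: "\<And>c. graph_cycle V E c \<Longrightarrow> 5 \<le> length c"
    and uv: "v \<in> V" "u \<noteq> v" "(u, v) \<in> (adj E)\<^sup>*"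
    and deg: "degree E u \<le> 2" "degree E v \<le> 2"
  obtains p where "graph_path V E p" "\<And>e. e \<in> E \<Longrightarrow> u \<in> e \<or> v \<in> e \<Longrightarrow> e \<in> walk_edges p"
proof -
  let ?P = "\<lambda>p. graph_path V E p \<and> hd p = u \<and> last p = v"
  have EV: "\<Union>E \<subseteq> V" using simple by (auto simp: simple_graph_def)
  obtain p\<^sub>0 where "?P p\<^sub>0" using rtrancl_adj_imp_path[OF uv(3,1) EV] by metis
  then obtain p where p: "graph_path V E p" "hd p = u" "last p = v"
    and short: "\<And>q. ?P q \<Longrightarrow> length p \<le> length q"
    using ex_has_least_nat[of ?P p\<^sub>0 length] by blast
  have ne: "p \<noteq> []" using p(1) by (simp add: graph_path_def)
  have rev: "graph_path V E (rev p)" "hd (rev p) = v" "last (rev p) = u"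
    using p ne by (auto simp: graph_path_rev hd_rev last_rev)
  obtain l where l: "l = [] \<or> (\<exists>x. l = [x] \<and> x \<in> V \<and> x \<notin> set p \<and> {x, u} \<in> E)"
    and lu: "\<And>e. e \<in> E \<Longrightarrow> u \<in> e \<Longrightarrow> e \<in> walk_edges (l @ p)"
    using shortest_path_prolong[OF simple p(1)] p uv short deg by metis
  have short': "length (rev p) \<le> length q" if "graph_path V E q" "hd q = v" "last q = u" for q
  proof -
    have "q \<noteq> []" using that by (simp add: graph_path_def)
    then show ?thesis using short[of "rev q"] that by (simp add: graph_path_rev hd_rev last_rev)
  qed
  obtain r where r: "r = [] \<or> (\<exists>y. r = [y] \<and> y \<in> V \<and> y \<notin> set p \<and> {y, v} \<in> E)"
    and rv: "\<And>e. e \<in> E \<Longrightarrow> v \<in> e \<Longrightarrow> e \<in> walk_edges (r @ rev p)"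
    using shortest_path_prolong[OF simple rev(1)] rev uv short' deg by (metis set_rev)
  \<comment> \<open>A common new vertex \<open>x\<close> would give a path from \<open>u\<close> to
    \<open>v\<close> with three vertices. The shortest path then has at most three vertices, and
    \<open>x\<close> closes it to a cycle of length at most 4.\<close>
  have disj: "set l \<inter> set r = {}"
  proof (rule ccontr)
    assume "set l \<inter> set r \<noteq> {}"
    then obtain x where x: "x \<in> V" "x \<notin> set p" "{x, u} \<in> E" "{x, v} \<in> E" using l r by auto
    have "v \<in> set p" "u \<in> set p" using p ne by auto
    then have "graph_path V E [u, x, v]"
      using x uv EV by (auto simp: graph_path_def insert_commute)
    then have "length p \<le> 3" using short[of "[u, x, v]"] by simp
    moreover have "length p \<ge> 2" using p uv(2) ne by (cases p rule: walk_edges.cases) auto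
    moreover have "graph_path V E (x # p)" using graph_path_Cons p x by metis
    then have "graph_cycle V E (x # p)"
      using x p ne \<open>length p \<ge> 2\<close> by (simp add: graph_cycle_def insert_commute)
    ultimately show False using girth by fastforce
  qed
  \<comment> \<open>\<open>r\<close> has at most one entry, so prolonging the reversed path at its
    front amounts to appending \<open>r\<close> to \<open>p\<close>.\<close>
  have revr: "rev r = r" using r by auto
  have lp: "graph_path V E (l @ p)" using l graph_path_Cons p by fastforce
  have q: "graph_path V E (l @ p @ r)"
  proof (cases "r = []")
    case False
    then obtain y where "r = [y]" "y \<in> V" "y \<notin> set p" "{y, v} \<in> E" using r by auto
    then have "graph_path V E (y # rev (l @ p))"
      using lp disj p ne graph_path_rev[of V E "l @ p"]
      by (intro graph_path_Cons) (auto simp: hd_rev)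
    then have "graph_path V E (rev (y # rev (l @ p)))" by (simp only: graph_path_rev)
    then show ?thesis using \<open>r = [y]\<close> by simp
  qed (use lp in simp)
  have "e \<in> walk_edges (l @ p @ r)" if "e \<in> E" "u \<in> e \<or> v \<in> e" for e
    using that(2)
  proof
    assume "u \<in> e"
    then have "e \<in> walk_edges (rev (l @ p))" using lu that by (simp only: walk_edges_rev)
    then have "e \<in> walk_edges (rev r @ rev (l @ p))" using walk_edges_suffix by blast
    then have "e \<in> walk_edges (rev (l @ p @ r))" by simp
    then show ?thesis by (simp only: walk_edges_rev)
  next
    assume "v \<in> e"
    then have "e \<in> walk_edges (rev (r @ rev p))" using rv that by (simp only: walk_edges_rev)
    then show ?thesis using walk_edges_suffix[of "p @ r" l] revr by auto
  qed
  then show thesis using that q by blast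
qed

section \<open>Induction on the number of edges\<close>

lemma planar_subset_edges:
  assumes "planar V E" "F \<subseteq> E"
  shows "planar V F"
proof -
  obtain ps \<gamma> where "plane_drawing V E ps \<gamma>" using assms(1) by (auto simp: planar_def)
  then have "plane_drawing V F ps \<gamma>"
    using assms(2) unfolding plane_drawing_def by (simp add: subset_iff)
  then show ?thesis by (auto simp: planar_def)
qed

text \<open>Removing a path may disconnect the graph but preserves planarity and the bound on cycle
  lengths, so these are what the induction carries. \<open>finite D\<close> excludes the default
  value 0 of \<open>card\<close> on infinite sets.\<close>

lemma planar_girth6_decomposition:
  assumes "simple_graph V E" "planar V E" "\<And>c. graph_cycle V E c \<Longrightarrow> 6 \<le> length c"
  shows "\<exists>D. path_decomposition V E D \<and> finite D \<and> card D \<le> card {v \<in> V. degree E v > 0} div 2"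
  using assms
proof (induction "card E" arbitrary: E rule: less_induct)
  case less
  have finE: "finite E" and finV: "finite V"
    using less.prems(1) simple_graph_finite_edges by (auto simp: simple_graph_def)
  show ?case
  proof (cases "E = {}")
    case True
    then show ?thesis by (intro exI[of _ "{}"]) (auto simp: path_decomposition_def)
  next
    case False
    obtain u v where uv: "u \<in> V" "v \<in> V" "u \<noteq> v" "(u, v) \<in> (adj E)\<^sup>*"
      and deg: "0 < degree E u" "degree E u \<le> 2" "0 < degree E v" "degree E v \<le> 2"
      using low_degree_pair[OF less.prems False] by metis
    have "\<And>c. graph_cycle V E c \<Longrightarrow> 5 \<le> length c" using less.prems(3) by fastforce
    then obtain p where p: "graph_path V E p"
      and cov: "\<And>e. e \<in> E \<Longrightarrow> u \<in> e \<or> v \<in> e \<Longrightarrow> e \<in> walk_edges p"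
      using path_through_low_degree_pair[OF less.prems(1) _ uv(2-4) deg(2,4)] by metis
    let ?F = "E - walk_edges p"
    obtain e where "e \<in> E" "u \<in> e" using deg(1) by (auto simp: degree_def card_gt_0_iff)
    then have "?F \<subset> E" using cov by blast
    then have "card ?F < card E" using finE by (simp add: psubset_card_mono)
    moreover have "simple_graph V ?F" using less.prems(1) by (simp add: simple_graph_def)
    moreover have "planar V ?F" using less.prems(2) planar_subset_edges by blast
    moreover have "6 \<le> length c" if "graph_cycle V ?F c" for c
      using that by (intro less.prems(3)) (auto simp: graph_cycle_def graph_path_def)
    ultimately obtain D where D: "path_decomposition V ?F D" "finite D"
      "card D \<le> card {v \<in> V. degree ?F v > 0} div 2"
      using less.hyps[of ?F] by blast
    have "path_decomposition V E (insert p D)"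
      using D(1) p by (auto simp: path_decomposition_def pairwise_insert disjnt_def graph_path_def)
    moreover have "card (insert p D) \<le> card {v \<in> V. degree E v > 0} div 2"
    proof -
      have le: "degree ?F w \<le> degree E w" for w
        unfolding degree_def by (rule card_mono) (use finE in auto)
      \<comment> \<open>The path contains all edges at \<open>u\<close> and \<open>v\<close>, so
        both become isolated and no other vertex becomes non-isolated.\<close>
      have "degree ?F u = 0" "degree ?F v = 0" using cov by (auto simp: degree_def card_eq_0_iff)
      then have "{w \<in> V. degree ?F w > 0} \<subseteq> {w \<in> V. degree E w > 0} - {u, v}"
        using le less_le_trans by force
      then have "card {w \<in> V. degree ?F w > 0} \<le> card ({w \<in> V. degree E w > 0} - {u, v})"
        using finV by (intro card_mono) auto
      also have "\<dots> = card {w \<in> V. degree E w > 0} - 2"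
        using uv deg by (subst card_Diff_subset) auto
      finally have 1: "card {w \<in> V. degree ?F w > 0} \<le> card {w \<in> V. degree E w > 0} - 2" .
      \<comment> \<open>Subtraction of naturals truncates; only from 2 on does lowering the vertex
        count by 2 lower its half by exactly the one path added.\<close>
      have "card {u, v} \<le> card {w \<in> V. degree E w > 0}"
        using uv deg finV by (intro card_mono) auto
      then have 2: "2 \<le> card {w \<in> V. degree E w > 0}" using uv(3) by simp
      have "card (insert p D) \<le> Suc (card D)" by (rule card_insert_le_m1) (use D in auto)
      then show ?thesis using 1 2 D(3) by linarith
    qed
    ultimately show ?thesis using D(2) by blast
  qed
qed

theorem theorem2p2:
  fixes V :: "'a set" and E :: "'a set set"
  assumes "simple_graph V E"
    and "graph_connected V E"
    and "planar V E"
    and "girth V E \<ge> 6"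
  shows "gallai_graph V E"
proof -
  have "6 \<le> length c" if "graph_cycle V E c" for c
  proof -
    have "girth V E \<le> enat (length c)" unfolding girth_def using that by (intro INF_lower) auto
    then have "enat 6 \<le> enat (length c)" using assms(4) by (simp add: numeral_eq_enat del: enat_ord_simps)
    then show ?thesis using enat_ord_simps(1) by blast
  qed
  then obtain D where D: "path_decomposition V E D" "card D \<le> card {v \<in> V. degree E v > 0} div 2"
    using planar_girth6_decomposition[OF assms(1,3)] by blast
  have "pn V E \<le> card D" unfolding pn_def by (rule Least_le) (use D in blast)
  then show ?thesis using D(2) by (simp add: gallai_graph_def)
qed

end
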